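(* Given any growth function $g(T)$ and any $n\ge 1$, there is a translation-minimal aperiodic Meyer set $Y$ in $\mathbb{R}^n$ with patch-counting function $N_Y(T)=O(T^n)$ whose repetitivity function satisfies $$M_Y(T_i)>g(T_i),\qquad i=1,2,\ldots,$$ for a sequence of $T_i\to\infty$.
   Context: A growth function is a continuous nondecreasing function $g:\mathbb{R}^+\to\mathbb{R}^+$. A Delone set in $\mathbb{R}^n$ is a set $X\subset\mathbb{R}^n$ for which there are $r,R>0$ such that each open ball of radius $r$ contains at most one point of $X$ and each closed ball of radius $R$ contains at least one point of $X$. A Meyer set is a Delone set $X$ such that $X-X=\{\mathbf{x}-\mathbf{y}:\mathbf{x},\mathbf{y}\in X\}$ is also a Delone set. $X$ is aperiodic if $X+\mathbf{t}=X$ only for $\mathbf{t}=\mathbf{0}$. $B(\mathbf{x};T)$ is the closed ball of radius $T$ centered at $\mathbf{x}$. The $T$-atlas of $X$ is $\mathcal{A}_X(T)=\{(X\cap B(\mathbf{x};T))-\mathbf{x}:\mathbf{x}\in X\}$, and the atlas is $\mathcal{A}_X=\bigcup_{T>0}\mathcal{A}_X(T)$. $N_X(T)=|\mathcal{A}_X(T)|$. A Delone set $X$ is translation-minimal if every Delone set $X'$ with $\mathcal{A}_{X'}\subseteq\mathcal{A}_X$ satisfies $\mathcal{A}_{X'}=\mathcal{A}_X$. The repetitivity function $M_X(T)$ is the least $M$ such that every closed ball of radius $M$ in $\mathbb{R}^n$ contains, for every $\mathcal{P}\in\mathcal{A}_X(T)$, some $\mathbf{x}\in X$ with $(X\cap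 B(\mathbf{x};T))-\mathbf{x}=\mathcal{P}$ (it is finite for all $T$ when $X$ is a translation-minimal Meyer set). *)

theory Defs
  imports "HOL-Analysis.Analysis" "HOL-Library.Landau_Symbols"
begin

text \<open>Here \<open>\<real>\<^sup>+\<close> is the open half-line of positive reals; values of \<open>g\<close> elsewhere are ignored.\<close>

definition growth_function :: "(real \<Rightarrow> real) \<Rightarrow> bool" where
  "growth_function g \<longleftrightarrow>
     continuous_on {0<..} g \<and> mono_on {0<..} g \<and> (\<forall>T>0. g T > 0)"

definition delone_set :: "'a::euclidean_space set \<Rightarrow> bool" where
  "delone_set X \<longleftrightarrow>
     (\<exists>r>0. \<exists>R>0.
        (\<forall>c. \<forall>x \<in> X \<inter> ball c r. \<forall>y \<in> X \<inter> ball c r. x = y) \<and>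
        (\<forall>c. X \<inter> cball c R \<noteq> {}))"

definition difference_set :: "'a::euclidean_space set \<Rightarrow> 'a set" where
  "difference_set X = {x - y | x y. x \<in> X \<and> y \<in> X}"

definition meyer_set :: "'a::euclidean_space set \<Rightarrow> bool" where
  "meyer_set X \<longleftrightarrow> delone_set X \<and> delone_set (difference_set X)"

definition aperiodic_set :: "'a::euclidean_space set \<Rightarrow> bool" where
  "aperiodic_set X \<longleftrightarrow> (\<forall>t. (\<lambda>x. x + t) ` X = X \<longrightarrow> t = 0)"

definition patch :: "'a::euclidean_space set \<Rightarrow> real \<Rightarrow> 'a \<Rightarrow> 'a set" where
  "patch X T x = (\<lambda>y. y - x) ` (X \<inter> cball x T)"

definition atlas_at :: "'a::euclidean_space set \<Rightarrow> real \<Rightarrow> 'a set set" where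
  "atlas_at X T = patch X T ` X"

definition atlas :: "'a::euclidean_space set \<Rightarrow> 'a set set" where
  "atlas X = (\<Union>T\<in>{0<..}. atlas_at X T)"

text \<open>For Meyer sets all \<open>atlas_at X T\<close> are finite (shown below), so \<^const>\<open>card\<close> is then the
  genuine cardinality.\<close>

definition patch_count :: "'a::euclidean_space set \<Rightarrow> real \<Rightarrow> nat" where
  "patch_count X T = card (atlas_at X T)"

definition translation_minimal :: "'a::euclidean_space set \<Rightarrow> bool" where
  "translation_minimal X \<longleftrightarrow>
     delone_set X \<and>
     (\<forall>X'. delone_set X' \<and> atlas X' \<subseteq> atlas X \<longrightarrow> atlas X' = atlas X)"

definition repetition_radius :: "'a::euclidean_space set \<Rightarrow> real \<Rightarrow> real \<Rightarrow> bool" where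
  "repetition_radius X T M \<longleftrightarrow>
     (\<forall>c. \<forall>P \<in> atlas_at X T. \<exists>x \<in> X \<inter> cball c M. patch X T x = P)"

text \<open>If no radius works, the value is unspecified. If some radius works for a Delone set, a least one
  exists: the occurrences of a patch form a closed set, and negative radii give empty balls.
  For translation-minimal Meyer sets some radius always works.\<close>

definition repetitivity :: "'a::euclidean_space set \<Rightarrow> real \<Rightarrow> real" where
  "repetitivity X T = (LEAST M. repetition_radius X T M)"

lemma finite_delone_Int_cball:
  fixes X :: "'a::euclidean_space set"
  assumes "delone_set X"
  shows "finite (X \<inter> cball c T)"
proof -
  obtain r where r: "r > 0"
    and sep: "\<And>c x y. x \<in> X \<inter> ball c r \<Longrightarrow> y \<in> X \<inter> ball c r \<Longrightarrow> x = y"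
    using assms unfolding delone_set_def by blast
  have "\<not> z islimpt X \<inter> cball c T" for z
  proof
    assume "z islimpt X \<inter> cball c T"
    then have "infinite (X \<inter> cball c T \<inter> ball z r)"
      using r by (simp add: islimpt_eq_infinite_ball)
    moreover have "finite (X \<inter> cball c T \<inter> ball z r)"
    proof (cases "X \<inter> ball z r = {}")
      case True
      then have "X \<inter> cball c T \<inter> ball z r = {}" by blast
      then show ?thesis by simp
    next
      case False
      then obtain p where p: "p \<in> X \<inter> ball z r" by blast
      have "X \<inter> cball c T \<inter> ball z r \<subseteq> {p}"
        using sep[OF _ p] by blast
      then show ?thesis by (rule finite_subset) simp
    qed
    ultimately show False by blast
  qed
  moreover have "bounded (X \<inter> cball c T)"
    by (simp add: bounded_Int)
  ultimately show ?thesis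
    using bounded_infinite_imp_islimpt[of "X \<inter> cball c T" "X \<inter> cball c T"] by blast
qed

lemma finite_atlas_at:
  fixes X :: "'a::euclidean_space set"
  assumes "meyer_set X"
  shows "finite (atlas_at X T)"
proof -
  have "atlas_at X T \<subseteq> Pow (difference_set X \<inter> cball 0 T)"
    by (auto simp: atlas_at_def patch_def difference_set_def dist_norm norm_minus_commute)
  moreover have "finite (Pow (difference_set X \<inter> cball 0 T))"
    using assms finite_delone_Int_cball unfolding meyer_set_def by blast
  ultimately show ?thesis
    by (rule finite_subset)
qed

end

theory Submission
  imports Defs
begin

text \<open>
  Let \<open>q 0 = 1\<close> and let each \<open>q k\<close> divide \<open>q (k + 1)\<close>. The integers whose level, the last \<open>k\<close> with
  \<open>q k dvd a\<close>, is even form a Toeplitz set \<open>X\<close>. At scales below \<open>q (k + 1)\<close> it is \<open>q k\<close>-periodic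
  with at most one deviation, so it has linearly many patches; the deviations recur only with period
  \<open>q (k + 1)\<close>, so a rapidly growing \<open>q\<close> makes the repetitivity at \<open>q k\<close> exceed any given growth
  function. Minimality follows from repetitivity, and both it and the other properties pass from \<open>X\<close>
  to the Cartesian power \<open>X\<^sup>n\<close>, a patch of which is determined by the patches of its
  coordinates; the Meyer property is automatic for a relatively dense set of integer points.
\<close>

section \<open>Patches and repetitivity\<close>

lemma patch_alt: "patch X T x = {d. norm d \<le> T \<and> x + d \<in> X}"
proof -
  have "d \<in> patch X T x" if "norm d \<le> T" "x + d \<in> X" for d
    unfolding patch_def using that
    by (intro image_eqI[of _ _ "x + d"]) (auto simp: dist_norm)
  then show ?thesis
    by (auto simp: patch_def dist_norm norm_minus_commute)
qed

lemma patch_eq_iff: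
  "patch X T x = patch X T x' \<longleftrightarrow> (\<forall>d. norm d \<le> T \<longrightarrow> (x + d \<in> X \<longleftrightarrow> x' + d \<in> X))"
  unfolding patch_alt by blast

text \<open>A large patch of \<open>X'\<close> is also a patch of \<open>X\<close>, so by
  repetitivity it contains a copy of any given patch \<open>P\<close> of \<open>X\<close>, which
  therefore occurs in \<open>X'\<close>.\<close>

lemma translation_minimal_if_repetitive:
  fixes X :: "'a::euclidean_space set"
  assumes X: "delone_set X" and rep: "\<And>T. \<exists>M. repetition_radius X T M"
  shows "translation_minimal X"
  unfolding translation_minimal_def
proof (intro conjI allI impI)
  fix X' :: "'a set"
  assume "delone_set X' \<and> atlas X' \<subseteq> atlas X"
  then have sub: "atlas X' \<subseteq> atlas X"
    and "\<exists>R>0. \<forall>c. X' \<inter> cball c R \<noteq> {}"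
    unfolding delone_set_def by blast+
  then obtain R where R: "R > 0" "\<And>c. X' \<inter> cball c R \<noteq> {}" by blast
  obtain x' where x': "x' \<in> X'" using R(2) by blast
  have "P \<in> atlas X'" if "P \<in> atlas X" for P
  proof -
    obtain T where T: "T > 0" and P: "P \<in> atlas_at X T"
      using \<open>P \<in> atlas X\<close> unfolding atlas_def by blast
    obtain M where M: "repetition_radius X T M" using rep by blast
    \<comment> \<open>Radius \<open>M + T\<close> leaves room for a copy of \<open>P\<close> centred
      within \<open>M\<close>; the extra \<open>2 * R + 1\<close> serves the comparison with
      \<open>U\<close> below.\<close>
    define T' where "T' = \<bar>M\<bar> + T + 2 * R + 1"
    have T': "T' > 0" using R T unfolding T'_def by linarith
    have "patch X' T' x' \<in> atlas X'"
      using x' T' unfolding atlas_def atlas_at_def by auto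
    then obtain U x where U: "U > 0" and x: "x \<in> X" and eq: "patch X' T' x' = patch X U x"
      using sub unfolding atlas_def atlas_at_def by blast
    text \<open>The atlas forgets the radius of a patch, but a ball missing \<open>X'\<close> has radius below
      \<open>R\<close>, so the radii \<open>T'\<close> and \<open>U\<close> cannot differ by much in the bad direction.\<close>
    have U': "U \<ge> M + T"
    proof (rule ccontr)
      assume "\<not> U \<ge> M + T"
      then have less: "U + 2 * R + 1 < T'" unfolding T'_def by linarith
      obtain e :: 'a where e: "norm e = 1" using norm_Basis nonempty_Basis by blast
      \<comment> \<open>The ball of radius \<open>R\<close> about \<open>x' + v\<close> stays
        farther than \<open>U\<close> from \<open>x'\<close> but within \<open>T'\<close>, so a
        point of \<open>X'\<close> in it shows up in only one of the two equal patches.\<close>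
      define v where "v = (U + R + 1/2) *\<^sub>R e"
      have nv: "norm v = U + R + 1/2" using U R e unfolding v_def by simp
      obtain p where p: "p \<in> X'" "dist (x' + v) p \<le> R" using R(2)[of "x' + v"] by auto
      have d: "norm (v - (p - x')) \<le> R" using p(2) by (simp add: dist_norm algebra_simps)
      have "norm (p - x') \<le> norm v + norm (v - (p - x'))"
        using norm_triangle_ineq4[of v "v - (p - x')"] by simp
      then have "norm (p - x') \<le> T'" using nv d less by linarith
      then have "p - x' \<in> patch X U x"
        using p unfolding eq[symmetric] unfolding patch_alt by simp
      then have "norm (p - x') \<le> U" unfolding patch_alt by simp
      moreover have "norm v \<le> norm (v - (p - x')) + norm (p - x')"
        using norm_triangle_ineq[of "v - (p - x')" "p - x'"] by simp
      ultimately show False using nv d by linarith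
    qed
    have "\<exists>y \<in> X \<inter> cball x M. patch X T y = P"
      using M P unfolding repetition_radius_def by blast
    then obtain y where y: "y \<in> X" "dist x y \<le> M" "patch X T y = P" by auto
    have agree: "x + d \<in> X \<longleftrightarrow> x' + d \<in> X'" if "norm d \<le> M + T" for d
    proof -
      have "norm d \<le> U" "norm d \<le> T'" using that U' R unfolding T'_def by linarith+
      then show ?thesis using eq unfolding patch_alt by blast
    qed
    have near: "y + d \<in> X \<longleftrightarrow> x' + (y - x) + d \<in> X'" if "norm d \<le> T" for d
    proof -
      have "norm (y - x + d) \<le> M + T"
        using norm_triangle_ineq[of "y - x" d] that y(2)
        by (simp add: dist_norm norm_minus_commute)
      from agree[OF this] show ?thesis by (simp add: algebra_simps)
    qed
    have "x' + (y - x) \<in> X'" using near[of 0] y(1) T by simp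
    moreover have "patch X' T (x' + (y - x)) = P"
      unfolding y(3)[symmetric] patch_alt using near by blast
    ultimately show ?thesis using T unfolding atlas_def atlas_at_def by auto
  qed
  then show "atlas X' = atlas X" using sub by blast
qed (fact X)

text \<open>The infimum of the working radii is attained: only finitely many occurrences of a patch
  lie within \<open>M\<close> of a centre, and the nearest of them is within every working
  radius.\<close>

lemma repetition_radius_repetitivity:
  fixes X :: "'a::euclidean_space set"
  assumes X: "delone_set X" and M: "repetition_radius X T M"
  shows "repetition_radius X T (repetitivity X T)"
proof -
  obtain x0 where x0: "x0 \<in> X" using X unfolding delone_set_def by blast
  have bound: "0 \<le> M'" if "repetition_radius X T M'" for M'
  proof -
    have "X \<inter> cball x0 M' \<noteq> {}"
      using that x0 unfolding repetition_radius_def atlas_at_def by blast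
    then show ?thesis by (metis Int_empty_right cball_eq_empty linorder_not_less)
  qed
  define L where "L = Inf {M'. repetition_radius X T M'}"
  have L_le: "L \<le> M'" if "repetition_radius X T M'" for M'
    unfolding L_def using that bound by (intro cInf_lower bdd_belowI[of _ 0]) auto
  have "repetition_radius X T L"
    unfolding repetition_radius_def
  proof (intro allI ballI)
    fix c P assume P: "P \<in> atlas_at X T"
    define C where "C = {x \<in> X \<inter> cball c M. patch X T x = P}"
    have "C \<subseteq> X \<inter> cball c M" unfolding C_def by blast
    then have C: "finite C" using finite_delone_Int_cball[OF X] finite_subset by blast
    have "\<exists>x \<in> X \<inter> cball c M. patch X T x = P"
      using M P unfolding repetition_radius_def by blast
    then have C_ne: "C \<noteq> {}" unfolding C_def by blast
    obtain x where x: "x \<in> C" and min: "\<And>y. y \<in> C \<Longrightarrow> dist c x \<le> dist c y"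
      using arg_min_if_finite(1)[OF C C_ne, of "dist c"] arg_min_least[OF C C_ne, of _ "dist c"]
      by blast
    have "dist c x \<le> M'" if M': "repetition_radius X T M'" for M'
    proof -
      obtain y where y: "y \<in> X \<inter> cball c M'" "patch X T y = P"
        using M' P unfolding repetition_radius_def by blast
      show ?thesis
      proof (cases "y \<in> C")
        case True
        then show ?thesis using min[OF True] y by simp
      next
        case False
        then have "dist c y > M" using y unfolding C_def by auto
        then show ?thesis using x y unfolding C_def by auto
      qed
    qed
    then have "dist c x \<le> L" unfolding L_def using M by (intro cInf_greatest) auto
    then show "\<exists>x\<in>X \<inter> cball c L. patch X T x = P" using x unfolding C_def by auto
  qed
  then show ?thesis
    unfolding repetitivity_def using L_le by (rule LeastI2_order) simp
qed

text \<open>Integer points are separated, differences of integer points are integer points, and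
  \<open>difference_set Y\<close> contains a translate of \<open>Y\<close>, so it inherits the
  covering radius \<open>R\<close>.\<close>

lemma meyer_setI_integer:
  fixes Y :: "(real ^ 'n) set"
  assumes int: "\<And>y i. y \<in> Y \<Longrightarrow> y $ i \<in> \<int>"
    and R: "\<And>c. Y \<inter> cball c R \<noteq> {}" "R > 0"
  shows "meyer_set Y"
proof -
  have sep: "x = y"
    if "\<And>i. x $ i \<in> \<int>" "\<And>i. y $ i \<in> \<int>" "x \<in> ball c (1/2)" "y \<in> ball c (1/2)"
    for x y c :: "real ^ 'n"
  proof (rule vec_eq_iff[THEN iffD2], rule allI)
    fix i
    have "dist x y < 1" using that(3,4) dist_triangle_half_r[of c x 1 y] by simp
    then have "\<bar>x $ i - y $ i\<bar> < 1"
      using component_le_norm_cart[of "x - y" i] by (simp add: dist_norm)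
    then show "x $ i = y $ i" using that(1,2)[of i] Ints_eq_abs_less1 by blast
  qed
  have delone: "delone_set Z"
    if "\<And>y i. y \<in> Z \<Longrightarrow> y $ i \<in> \<int>" "\<And>c. Z \<inter> cball c R \<noteq> {}" for Z :: "(real ^ 'n) set"
    unfolding delone_set_def
  proof (rule exI[of _ "1/2"], intro conjI exI[of _ R])
    show "\<forall>c. \<forall>x\<in>Z \<inter> ball c (1/2). \<forall>y\<in>Z \<inter> ball c (1/2). x = y"
      using sep that(1) by (metis IntD1 IntD2)
  qed (use R that(2) in auto)
  obtain y0 where y0: "y0 \<in> Y" using R(1) by blast
  have "difference_set Y \<inter> cball c R \<noteq> {}" for c
  proof -
    obtain y where "y \<in> Y" "dist (c + y0) y \<le> R" using R(1)[of "c + y0"] by auto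
    then have "y - y0 \<in> difference_set Y" "dist c (y - y0) \<le> R"
      using y0 unfolding difference_set_def by (blast, simp add: dist_norm algebra_simps)
    then have "y - y0 \<in> difference_set Y \<inter> cball c R" by simp
    then show ?thesis by blast
  qed
  moreover have "y $ i \<in> \<int>" if "y \<in> difference_set Y" for y i
    using that int unfolding difference_set_def by auto
  ultimately show ?thesis unfolding meyer_set_def using delone int R(1) by blast
qed

section \<open>Cartesian powers\<close>

definition cart_power :: "real set \<Rightarrow> (real ^ 'n) set" where
  "cart_power X = {v. \<forall>i. v $ i \<in> X}"

lemma cball_cart_power:
  fixes c :: "real ^ 'n"
  assumes "\<And>i. \<bar>c $ i - v $ i\<bar> \<le> M"
  shows "v \<in> cball c (real CARD('n) * M)"
proof -
  have "norm (c - v) \<le> (\<Sum>i\<in>UNIV. \<bar>(c - v) $ i\<bar>)" by (rule norm_le_l1_cart)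
  also have "\<dots> \<le> (\<Sum>i\<in>(UNIV :: 'n set). M)" using assms by (intro sum_mono) simp
  finally show ?thesis by (simp add: dist_norm)
qed

lemma patch_cart_power:
  fixes y :: "real ^ 'n"
  shows "patch (cart_power X) T y = {d. norm d \<le> T \<and> (\<forall>i. d $ i \<in> patch X T (y $ i))}"
proof -
  have "\<bar>d $ i\<bar> \<le> T" if "norm d \<le> T" for d :: "real ^ 'n" and i
    using that component_le_norm_cart[of d i] by linarith
  then show ?thesis by (auto simp: patch_alt cart_power_def)
qed

text \<open>A displacement along the \<open>i\<close>-th axis changes only one coordinate, so it
  tests membership of that coordinate in \<open>X\<close> alone.\<close>

lemma patch_cart_power_component:
  fixes y z :: "real ^ 'n"
  assumes "y \<in> cart_power X" "z \<in> cart_power X"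
    and eq: "patch (cart_power X) T y = patch (cart_power X) T z"
  shows "patch X T (y $ i) = patch X T (z $ i)"
  unfolding patch_eq_iff
proof (intro allI impI)
  fix d :: real assume "norm d \<le> T"
  moreover have "axis i d = d *\<^sub>R axis i (1 :: real)" by (simp add: vec_eq_iff axis_def)
  ultimately have "norm (axis i d) \<le> T" by simp
  then have "y + axis i d \<in> cart_power X \<longleftrightarrow> z + axis i d \<in> cart_power X"
    using eq unfolding patch_eq_iff by blast
  moreover have "w + axis i d \<in> cart_power X \<longleftrightarrow> w $ i + d \<in> X" if "w \<in> cart_power X" for w
  proof -
    have "(w + axis i d) $ j = (if j = i then w $ i + d else w $ j)" for j
      by (simp add: axis_def)
    then show ?thesis using that unfolding cart_power_def mem_Collect_eq by metis
  qed
  ultimately show "y $ i + d \<in> X \<longleftrightarrow> z $ i + d \<in> X" using assms(1,2) by blast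
qed

lemma patch_count_cart_power_le:
  assumes fin: "finite (atlas_at X T)"
  shows "patch_count (cart_power X :: (real ^ 'n) set) T \<le> patch_count X T ^ CARD('n)"
proof -
  let ?F = "(UNIV :: 'n set) \<rightarrow>\<^sub>E atlas_at X T"
  have "atlas_at (cart_power X :: (real ^ 'n) set) T \<subseteq>
      (\<lambda>f. {d. norm d \<le> T \<and> (\<forall>i. d $ i \<in> f i)}) ` ?F"
  proof
    fix P assume "P \<in> atlas_at (cart_power X :: (real ^ 'n) set) T"
    then obtain y :: "real ^ 'n"
      where y: "y \<in> cart_power X" "P = patch (cart_power X) T y"
      unfolding atlas_at_def by blast
    have "(\<lambda>i. patch X T (y $ i)) \<in> ?F"
      using y(1) unfolding atlas_at_def cart_power_def by auto
    then show "P \<in> (\<lambda>f. {d. norm d \<le> T \<and> (\<forall>i. d $ i \<in> f i)}) ` ?F"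
      unfolding y(2) patch_cart_power by (rule rev_image_eqI) simp
  qed
  moreover have "finite ?F" using fin by (intro finite_PiE) auto
  ultimately have "patch_count (cart_power X :: (real ^ 'n) set) T \<le> card ?F"
    unfolding patch_count_def by (rule surj_card_le[rotated])
  then show ?thesis by (simp add: card_PiE patch_count_def)
qed

lemma repetition_radius_cart_power:
  assumes "repetition_radius X T M"
  shows "repetition_radius (cart_power X :: (real ^ 'n) set) T (real CARD('n) * M)"
  unfolding repetition_radius_def
proof (intro allI ballI)
  fix c :: "real ^ 'n" and P assume "P \<in> atlas_at (cart_power X :: (real ^ 'n) set) T"
  then obtain y :: "real ^ 'n"
    where y: "y \<in> cart_power X" "P = patch (cart_power X) T y"
    unfolding atlas_at_def by blast
  have "\<exists>x \<in> X \<inter> cball (c $ i) M. patch X T x = patch X T (y $ i)" for i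
    using assms y(1) unfolding repetition_radius_def atlas_at_def cart_power_def by blast
  then obtain f where f: "\<And>i. f i \<in> X" "\<And>i. \<bar>c $ i - f i\<bar> \<le> M"
    "\<And>i. patch X T (f i) = patch X T (y $ i)"
    unfolding Int_iff mem_cball dist_real_def Bex_def by metis
  have "(\<chi> i. f i) \<in> cart_power X \<inter> cball c (real CARD('n) * M)"
    using f(1,2) cball_cart_power[of c "\<chi> i. f i" M] by (simp add: cart_power_def)
  moreover have "patch (cart_power X) T (\<chi> i. f i) = P"
    unfolding y(2) patch_cart_power using f(3) by simp
  ultimately show "\<exists>x \<in> cart_power X \<inter> cball c (real CARD('n) * M). patch (cart_power X) T x = P"
    by blast
qed

text \<open>Restriction to the diagonal: the patch of a constant vector is sought near a constant
  centre, and any one coordinate of the occurrence found serves for \<open>X\<close>. Lower bounds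
  on repetitivity thus pass to the power without loss.\<close>

lemma repetition_radius_cart_powerD:
  assumes "repetition_radius (cart_power X :: (real ^ 'n) set) T M"
  shows "repetition_radius X T M"
  unfolding repetition_radius_def
proof (intro allI ballI)
  fix c P assume "P \<in> atlas_at X T"
  then obtain x where x: "x \<in> X" "P = patch X T x" unfolding atlas_at_def by blast
  define y c' :: "real ^ 'n" where "y = (\<chi> i. x)" and "c' = (\<chi> i. c)"
  have y: "y \<in> cart_power X" using x(1) unfolding y_def cart_power_def by simp
  then obtain z where z: "z \<in> cart_power X" "dist c' z \<le> M"
    "patch (cart_power X) T z = patch (cart_power X) T y"
    using assms unfolding repetition_radius_def atlas_at_def by fastforce
  fix i :: 'n
  have "patch X T (z $ i) = P"
    using patch_cart_power_component[OF z(1) y z(3)] x(2) unfolding y_def by simp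
  moreover have "\<bar>c - z $ i\<bar> \<le> M"
    using component_le_norm_cart[of "c' - z" i] z(2) by (simp add: dist_norm c'_def)
  ultimately show "\<exists>x \<in> X \<inter> cball c M. patch X T x = P"
    using z(1) unfolding cart_power_def by (auto simp: dist_real_def)
qed

text \<open>Testing the period \<open>t\<close> on constant vectors and on their translates by
  \<open>-t\<close> shows that each \<open>t $ i\<close> is a period of \<open>X\<close>.\<close>

lemma aperiodic_cart_power:
  assumes "aperiodic_set X" "X \<noteq> {}"
  shows "aperiodic_set (cart_power X :: (real ^ 'n) set)"
  unfolding aperiodic_set_def
proof (intro allI impI)
  fix t :: "real ^ 'n"
  assume eq: "(\<lambda>v. v + t) ` cart_power X = cart_power X"
  obtain x0 where x0: "x0 \<in> X" using assms(2) by blast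
  have iff: "v + t \<in> cart_power X \<longleftrightarrow> v \<in> cart_power X" for v
    using eq by (metis (no_types, lifting) add_right_cancel image_iff)
  have "(\<lambda>x. x + t $ i) ` X = X" for i
  proof -
    have fwd: "x + t $ i \<in> X" if "x \<in> X" for x
    proof -
      have "(\<chi> j. x) \<in> (cart_power X :: (real ^ 'n) set)" using that by (simp add: cart_power_def)
      then show ?thesis using iff[of "\<chi> j. x"] by (simp add: cart_power_def)
    qed
    have bwd: "x - t $ i \<in> X" if "x \<in> X" for x
    proof -
      have "(\<chi> j. x) - t + t \<in> cart_power X" using that by (simp add: cart_power_def)
      then show ?thesis using iff[of "(\<chi> j. x) - t"] by (simp add: cart_power_def)
    qed
    show ?thesis using fwd bwd by (force intro: image_eqI[of _ _ "_ - t $ i"])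
  qed
  then have "t $ i = 0" for i using assms(1) unfolding aperiodic_set_def by blast
  then show "t = 0" by (simp add: vec_eq_iff)
qed

section \<open>Toeplitz sets\<close>

text \<open>A point of the set seen from an integer centre lies at an integer displacement, so only
  those matter.\<close>

lemma patch_of_int_eq_iff:
  "patch (real_of_int ` A) T (of_int a) = patch (real_of_int ` A) T (of_int b) \<longleftrightarrow>
     (\<forall>d. \<bar>of_int d\<bar> \<le> T \<longrightarrow> (a + d \<in> A \<longleftrightarrow> b + d \<in> A))" (is "?L \<longleftrightarrow> ?R")
proof
  assume L: ?L
  show ?R
  proof (intro allI impI)
    fix d :: int assume "\<bar>of_int d\<bar> \<le> T"
    then have "of_int a + real_of_int d \<in> real_of_int ` A \<longleftrightarrow>
        of_int b + real_of_int d \<in> real_of_int ` A"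
      using L unfolding patch_eq_iff by auto
    then show "a + d \<in> A \<longleftrightarrow> b + d \<in> A"
      by (simp flip: of_int_add add: inj_image_mem_iff inj_def)
  qed
next
  assume R: ?R
  have sub: "of_int b + d \<in> real_of_int ` A"
    if R: "\<And>d. \<bar>of_int d\<bar> \<le> T \<Longrightarrow> a + d \<in> A \<longleftrightarrow> b + d \<in> A"
      and d: "\<bar>d\<bar> \<le> T" "of_int a + d \<in> real_of_int ` A" for a b d
  proof -
    obtain e where e: "e \<in> A" "of_int a + d = of_int e" using d(2) by blast
    then have "d = of_int (e - a)" by simp
    moreover have "b + (e - a) \<in> A" using R[of "e - a"] d(1) e(1) calculation by simp
    ultimately show ?thesis by (metis image_eqI of_int_add)
  qed
  show ?L unfolding patch_eq_iff real_norm_def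
    using sub[of a b] sub[of b a] R by blast
qed

text \<open>Every \<open>q k\<close> divides 0, so 0 has no level and is left out.\<close>

definition toeplitz :: "(nat \<Rightarrow> int) \<Rightarrow> int set" where
  "toeplitz q = {a. \<exists>k. even k \<and> q k dvd a \<and> \<not> q (Suc k) dvd a}"

text \<open>Doubling makes the chain unbounded, so every nonzero integer has a level.\<close>

locale divisor_chain =
  fixes q :: "nat \<Rightarrow> int"
  assumes q_0: "q 0 = 1"
    and q_dvd_Suc: "q k dvd q (Suc k)"
    and q_Suc_ge: "2 * q k \<le> q (Suc k)"
begin

section \<open>Levels in a divisor chain\<close>

lemma q_pos: "q k \<ge> 1"
proof (induction k)
  case (Suc k) then show ?case using q_Suc_ge[of k] by linarith
qed (simp add: q_0)

lemma q_less_Suc: "q k < q (Suc k)"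
  using q_Suc_ge[of k] q_pos[of k] by linarith

lemma q_dvd: "j \<le> k \<Longrightarrow> q j dvd q k"
  by (induction rule: dec_induct) (auto intro: dvd_trans q_dvd_Suc)

lemma q_ge_nat: "q k > int k"
proof (induction k)
  case (Suc k) then show ?case using q_less_Suc[of k] by linarith
qed (simp add: q_0)

lemma not_q_Suc_dvd_q: "\<not> q (Suc k) dvd q k"
  using q_less_Suc[of k] q_pos[of k] zdvd_not_zless by force

text \<open>The \<open>j\<close> with \<open>q j dvd a\<close> form an initial segment, so the level
  is unique.\<close>

lemma toeplitz_iff:
  assumes "q k dvd a" "\<not> q (Suc k) dvd a"
  shows "a \<in> toeplitz q \<longleftrightarrow> even k"
proof -
  have "j = k" if "q j dvd a" "\<not> q (Suc j) dvd a" for j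
  proof (rule ccontr)
    assume "j \<noteq> k"
    then have "Suc j \<le> k \<or> Suc k \<le> j" by linarith
    then show False using assms that q_dvd dvd_trans by blast
  qed
  then show ?thesis using assms unfolding toeplitz_def by blast
qed

text \<open>\<open>d\<close> has level below \<open>k\<close>, and adding a multiple of
  \<open>q k\<close> changes no divisibility by \<open>q j\<close> for
  \<open>j \<le> k\<close>.\<close>

lemma toeplitz_add_iff:
  assumes "q k dvd z" "\<not> q k dvd d"
  shows "z + d \<in> toeplitz q \<longleftrightarrow> d \<in> toeplitz q"
proof -
  have "q j dvd z + d \<and> \<not> q (Suc j) dvd z + d \<longleftrightarrow> q j dvd d \<and> \<not> q (Suc j) dvd d" for j
  proof (cases "j < k")
    case True
    then have "q j dvd z" "q (Suc j) dvd z" using assms(1) q_dvd dvd_trans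
      by (metis less_imp_le_nat, metis Suc_leI)
    then show ?thesis by (simp add: dvd_add_right_iff)
  next
    case False
    then have "q k dvd q j" using q_dvd by simp
    then have "\<not> q j dvd d" "\<not> q j dvd z + d"
      using assms dvd_trans dvd_add_right_iff by metis+
    then show ?thesis by simp
  qed
  then show ?thesis unfolding toeplitz_def by blast
qed

lemma one_in_toeplitz: "1 \<in> toeplitz q"
  using toeplitz_iff[of 0 1] q_0 not_q_Suc_dvd_q[of 0] by simp

lemma q_in_toeplitz_iff: "q k \<in> toeplitz q \<longleftrightarrow> even k"
  using toeplitz_iff[of k "q k"] not_q_Suc_dvd_q by simp

text \<open>Two consecutive integers are not both multiples of \<open>q (Suc 0)\<close>, which
  exceeds 1, and a nonmultiple has level 0.\<close>

lemma toeplitz_dense: "\<exists>x \<in> real_of_int ` toeplitz q. \<bar>c - x\<bar> \<le> 1"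
proof -
  have "\<not> q (Suc 0) dvd \<lfloor>c\<rfloor> \<or> \<not> q (Suc 0) dvd \<lfloor>c\<rfloor> + 1"
    using not_q_Suc_dvd_q[of 0] q_0 dvd_add_right_iff by metis
  then have "\<lfloor>c\<rfloor> \<in> toeplitz q \<or> \<lfloor>c\<rfloor> + 1 \<in> toeplitz q"
    using toeplitz_iff[of 0] q_0 by auto
  moreover have "\<bar>c - of_int \<lfloor>c\<rfloor>\<bar> \<le> 1" "\<bar>c - of_int (\<lfloor>c\<rfloor> + 1)\<bar> \<le> 1" by linarith+
  ultimately show ?thesis by blast
qed

text \<open>A translation by \<open>t\<close> would move \<open>q k\<close> and \<open>q (k + 1)\<close>, exactly one of which belongs to the
  set, to points with the same membership as \<open>t\<close> as soon as \<open>q k > \<bar>t\<bar>\<close>.\<close>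
lemma aperiodic_toeplitz: "aperiodic_set (real_of_int ` toeplitz q)"
  unfolding aperiodic_set_def
proof (intro allI impI)
  fix t :: real
  assume eq: "(\<lambda>x. x + t) ` real_of_int ` toeplitz q = real_of_int ` toeplitz q"
  have "1 + t \<in> real_of_int ` toeplitz q" using one_in_toeplitz eq by force
  then obtain s where "1 + t = real_of_int s" by blast
  then obtain u :: int where u: "t = of_int u" by (metis add_diff_cancel_left' of_int_1 of_int_diff)
  have iff: "a + u \<in> toeplitz q \<longleftrightarrow> a \<in> toeplitz q" for a
  proof -
    have "of_int a + t \<in> real_of_int ` toeplitz q \<longleftrightarrow> of_int a \<in> real_of_int ` toeplitz q"
      using eq by (metis (no_types, lifting) add_right_cancel image_iff)
    then show ?thesis unfolding u by (simp flip: of_int_add add: inj_image_mem_iff inj_def)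
  qed
  show "t = 0"
  proof (rule ccontr)
    assume "t \<noteq> 0"
    define k where "k = nat \<bar>u\<bar>"
    have "\<bar>u\<bar> < q k" using q_ge_nat[of k] unfolding k_def by simp
    then have "\<not> q k dvd u" using \<open>t \<noteq> 0\<close> u dvd_imp_le_int[of u "q k"] by auto
    then have "q k + u \<in> toeplitz q \<longleftrightarrow> q (Suc k) + u \<in> toeplitz q"
      using toeplitz_add_iff[of k _ u] q_dvd_Suc[of k] by simp
    then show False unfolding iff q_in_toeplitz_iff by simp
  qed
qed

text \<open>A window of length \<open>2 * T < q k\<close> shows at most one multiple
  \<open>z\<close> of \<open>q k\<close>, and everything else in it depends only on the displacement
  from \<open>z\<close>. Replacing \<open>z\<close> by any multiple \<open>z'\<close> of
  \<open>q k\<close> with the same membership keeps the patch.\<close>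

lemma repetition_radius_toeplitz:
  "\<exists>M. repetition_radius (real_of_int ` toeplitz q) T M"
proof -
  define k where "k = nat \<lceil>2 * T\<rceil>"
  have k: "2 * T < q k" using q_ge_nat[of k] unfolding k_def by linarith
  \<comment> \<open>Adding multiples of \<open>N\<close> to \<open>q k\<close> or
    \<open>q (Suc k)\<close> keeps its level, so either membership value recurs among the multiples
    of \<open>q k\<close> with period \<open>N\<close>.\<close>
  define N where "N = q (Suc (Suc k))"
  have "repetition_radius (real_of_int ` toeplitz q) T N"
    unfolding repetition_radius_def
  proof (intro allI ballI)
    fix c :: real and P assume "P \<in> atlas_at (real_of_int ` toeplitz q) T"
    then obtain a where a: "a \<in> toeplitz q"
      and P: "P = patch (real_of_int ` toeplitz q) T (of_int a)"
      unfolding atlas_at_def by blast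
    text \<open>The only visible multiple of \<open>q k\<close>, if there is one.\<close>
    obtain z where z: "q k dvd z" and z_only: "\<And>y. q k dvd y \<Longrightarrow> \<bar>y - a\<bar> \<le> T \<Longrightarrow> y = z"
    proof (cases "\<exists>z. q k dvd z \<and> \<bar>z - a\<bar> \<le> T")
      case True
      then obtain z where z: "q k dvd z" "\<bar>z - a\<bar> \<le> T" by blast
      have "y = z" if y: "q k dvd y" "\<bar>y - a\<bar> \<le> T" for y
      proof (rule ccontr)
        assume "y \<noteq> z"
        then have "\<bar>q k\<bar> \<le> \<bar>y - z\<bar>" using y(1) z(1) by (intro dvd_imp_le_int) auto
        moreover have "real_of_int \<bar>y - z\<bar> < q k" using k y(2) z(2) by linarith
        ultimately show False using q_pos[of k] by linarith
      qed
      then show thesis using that z by blast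
    next
      case False
      \<comment> \<open>With no multiple in view, \<open>z_only\<close> is vacuous and 0 serves as
        the reference point.\<close>
      then show thesis using that[of 0] by auto
    qed
    obtain j where j: "j = k \<or> j = Suc k" "z \<in> toeplitz q \<longleftrightarrow> even j"
      by (metis even_Suc)
    \<comment> \<open>This choice makes the floor of \<open>c\<close> minus \<open>b\<close> equal
      to \<open>m mod N\<close>, which puts \<open>b\<close> within \<open>N\<close> of
      \<open>c\<close>.\<close>
    define m where "m = \<lfloor>c\<rfloor> - (a - z) - q j"
    define z' where "z' = q j + N * (m div N)"
    have "q (Suc j) dvd N" unfolding N_def using j(1) q_dvd by auto
    then have *: "q (Suc j) dvd N * (m div N)" by simp
    then have "q j dvd z'" "\<not> q (Suc j) dvd z'"
      using dvd_trans[OF q_dvd_Suc *] not_q_Suc_dvd_q[of j]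
      unfolding z'_def by (simp_all add: dvd_add_left_iff)
    then have z'_mem: "z' \<in> toeplitz q \<longleftrightarrow> even j" and z'_dvd: "q k dvd z'"
      using toeplitz_iff[of j z'] dvd_trans[OF q_dvd[of k j]] j(1) by auto
    define b where "b = z' + (a - z)"
    have same: "a + d \<in> toeplitz q \<longleftrightarrow> b + d \<in> toeplitz q" if d: "\<bar>of_int d\<bar> \<le> T" for d
    proof (cases "q k dvd a + d - z")
      case True
      then have "q k dvd a + d" using z by (metis diff_add_cancel dvd_add)
      then have "a + d = z" using z_only d by simp
      then show ?thesis using j(2) z'_mem unfolding b_def by (simp add: add_diff_eq add.commute add.left_commute flip: \<open>a + d = z\<close>)
    next
      case False
      then show ?thesis
        using toeplitz_add_iff[OF z False] toeplitz_add_iff[OF z'_dvd False]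
        unfolding b_def by (simp add: algebra_simps)
    qed
    have patch_b: "patch (real_of_int ` toeplitz q) T (of_int b) = P"
      unfolding P patch_of_int_eq_iff using same by simp
    have N: "N > 0" unfolding N_def using q_pos by (simp add: int_one_le_iff_zero_less)
    have "\<lfloor>c\<rfloor> - b = m mod N"
      unfolding b_def z'_def m_def by (simp add: minus_mult_div_eq_mod[symmetric] algebra_simps)
    then have "0 \<le> \<lfloor>c\<rfloor> - b" "\<lfloor>c\<rfloor> - b \<le> N - 1"
      using N pos_mod_sign[of N m] pos_mod_bound[of N m] by simp_all
    then have near: "\<bar>c - b\<bar> \<le> N" by linarith
    show "\<exists>x \<in> real_of_int ` toeplitz q \<inter> cball c N. patch (real_of_int ` toeplitz q) T x = P"
    proof (cases "T \<ge> 0")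
      case True
      then have "b \<in> toeplitz q" using same[of 0] a by simp
      then show ?thesis using patch_b near by (auto simp: dist_real_def)
    next
      \<comment> \<open>For negative \<open>T\<close> all patches are empty, and any nearby point of
        the set will do.\<close>
      case False
      then have "patch (real_of_int ` toeplitz q) T x = P" for x
        unfolding P patch_alt using norm_ge_zero order_trans by blast
      moreover obtain x where "x \<in> real_of_int ` toeplitz q" "\<bar>c - x\<bar> \<le> 1"
        using toeplitz_dense by blast
      moreover have "1 \<le> real_of_int N" using N by linarith
      ultimately show ?thesis by (intro bexI[of _ x]) (auto simp: dist_real_def)
    qed
  qed
  then show ?thesis by blast
qed

text \<open>Away from the multiples of \<open>q (k + 1)\<close> the set looks \<open>q k\<close>-periodic.\<close>
lemma toeplitz_cong:
  assumes "q k dvd b - a"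
    and "q (Suc k) dvd a \<Longrightarrow> a \<in> toeplitz q \<longleftrightarrow> even k"
    and "q (Suc k) dvd b \<Longrightarrow> b \<in> toeplitz q \<longleftrightarrow> even k"
  shows "a \<in> toeplitz q \<longleftrightarrow> b \<in> toeplitz q"
proof (cases "q k dvd a")
  case True
  then have "q k dvd b" using assms(1) by (metis diff_add_cancel dvd_add)
  then show ?thesis using True assms(2,3) toeplitz_iff by blast
next
  case False
  then show ?thesis using toeplitz_add_iff[OF assms(1) False] by simp
qed

text \<open>For \<open>q k \<le> 2 * T < q (k + 1)\<close> a patch either shows the \<open>q k\<close>-periodic pattern, and is given by
  the residue of its centre, or it shows a single deviation from it, and is given by the position
  of that deviation.\<close>
lemma patch_count_toeplitz_le:
  assumes T: "T \<ge> 1"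
  shows "finite (atlas_at (real_of_int ` toeplitz q) T)"
    and "real (patch_count (real_of_int ` toeplitz q) T) \<le> 5 * T"
proof -
  define k where "k = (LEAST k. 2 * T < q (Suc k))"
  have "2 * T < q (Suc (nat \<lceil>2 * T\<rceil>))"
    using q_ge_nat[of "Suc (nat \<lceil>2 * T\<rceil>)"] by linarith
  then have upper: "2 * T < q (Suc k)" unfolding k_def by (rule LeastI)
  have lower: "q k \<le> 2 * T"
  proof (cases k)
    case 0 then show ?thesis using T q_0 by simp
  next
    case (Suc j)
    then show ?thesis using not_less_Least[of j "\<lambda>k. 2 * T < q (Suc k)"] unfolding k_def by auto
  qed
  \<comment> \<open>Not every visible multiple of \<open>q (Suc k)\<close> deviates: one of level
    \<open>k + 2\<close> fits the periodic pattern.\<close>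
  define special where
    "special a z \<longleftrightarrow> q (Suc k) dvd z \<and> \<bar>real_of_int (z - a)\<bar> \<le> T \<and> (z \<in> toeplitz q \<longleftrightarrow> odd k)" for a z
  define h where
    "h a = (if \<exists>z. special a z then Inr (a - (SOME z. special a z)) else Inl (a mod q k))" for a
  \<comment> \<open>There are at most \<open>2 * T + (2 * T + 1)\<close> codes, hence at most
    \<open>5 * T\<close> since \<open>T \<ge> 1\<close>.\<close>
  define C where "C = {0..<q k} <+> {-\<lfloor>T\<rfloor>..\<lfloor>T\<rfloor>}"
  define p where "p a = patch (real_of_int ` toeplitz q) T (real_of_int a)" for a
  have hC: "h a \<in> C" for a
  proof (cases "\<exists>z. special a z")
    case True
    then have "special a (SOME z. special a z)" by (rule someI_ex)
    then have "\<bar>real_of_int ((SOME z. special a z) - a)\<bar> \<le> T" unfolding special_def by blast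
    then have "a - (SOME z. special a z) \<in> {-\<lfloor>T\<rfloor>..\<lfloor>T\<rfloor>}" by (auto simp: le_floor_iff) linarith+
    then show ?thesis using True unfolding h_def C_def by auto
  next
    case False
    then show ?thesis using q_pos[of k] unfolding h_def C_def by (auto simp: int_one_le_iff_zero_less)
  qed
  have p_eq: "p a = p b" if "h a = h b" for a b
    unfolding p_def patch_of_int_eq_iff
  proof (intro allI impI)
    fix d :: int assume d: "\<bar>of_int d\<bar> \<le> T"
    show "a + d \<in> toeplitz q \<longleftrightarrow> b + d \<in> toeplitz q"
    proof (cases "\<exists>z. special a z")
      case True
      then have "\<exists>z. special b z" using \<open>h a = h b\<close> unfolding h_def by (auto split: if_splits)
      then obtain z w where z: "special a z" and w: "special b w" and zw: "a - z = b - w"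
        using True \<open>h a = h b\<close> someI_ex[of "special a"] someI_ex[of "special b"]
        unfolding h_def by auto
      show ?thesis
      proof (cases "a + d = z")
        case True
        then have "b + d = w" using zw by simp
        then show ?thesis using True z w unfolding special_def by blast
      next
        case False
        \<comment> \<open>Two visible points are less than \<open>q (Suc k)\<close> apart, so a
          visible point other than \<open>z\<close> has the same membership as the point at the same
          displacement from \<open>w\<close>.\<close>
        have "\<not> q (Suc k) dvd a + d - z"
        proof
          assume "q (Suc k) dvd a + d - z"
          then have "\<bar>q (Suc k)\<bar> \<le> \<bar>a + d - z\<bar>" using False by (intro dvd_imp_le_int) auto
          moreover have "real_of_int \<bar>a + d - z\<bar> < q (Suc k)"
            using z d upper unfolding special_def by linarith
          ultimately show False using q_pos[of "Suc k"] by linarith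
        qed
        then have "z + (a + d - z) \<in> toeplitz q \<longleftrightarrow> w + (a + d - z) \<in> toeplitz q"
          using toeplitz_add_iff z w unfolding special_def by blast
        moreover have "z + (a + d - z) = a + d" "w + (a + d - z) = b + d" using zw by simp_all
        ultimately show ?thesis by metis
      qed
    next
      case False
      then have nb: "\<nexists>z. special b z" and "a mod q k = b mod q k"
        using \<open>h a = h b\<close> unfolding h_def by (auto split: if_splits)
      then have "q k dvd (b + d) - (a + d)" by (metis add_diff_cancel_right mod_eq_dvd_iff)
      moreover have "\<not> special a (a + d)" "\<not> special b (b + d)" using False nb by blast+
      ultimately show ?thesis
        using d toeplitz_cong[of k "b + d" "a + d"] unfolding special_def by auto
    qed
  qed
  have finC: "finite C" unfolding C_def by simp
  have atlas: "atlas_at (real_of_int ` toeplitz q) T = p ` toeplitz q"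
    unfolding atlas_at_def p_def by (simp add: image_image)
  \<comment> \<open>Any centre with a given code yields the patch of that code, so a choice of
    representatives covers the atlas.\<close>
  also have "\<dots> \<subseteq> (\<lambda>c. p (SOME a. h a = c)) ` C"
  proof
    fix P assume "P \<in> p ` toeplitz q"
    then obtain a where "P = p a" by blast
    moreover have "h (SOME b. h b = h a) = h a" by (rule someI) simp
    ultimately have "P = p (SOME b. h b = h a)" using p_eq[of a "SOME b. h b = h a"] by simp
    then show "P \<in> (\<lambda>c. p (SOME a. h a = c)) ` C" using hC by (rule image_eqI)
  qed
  finally have sub: "atlas_at (real_of_int ` toeplitz q) T \<subseteq> (\<lambda>c. p (SOME a. h a = c)) ` C" .
  then show "finite (atlas_at (real_of_int ` toeplitz q) T)"
    by (rule finite_subset) (simp add: finC)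
  have "patch_count (real_of_int ` toeplitz q) T \<le> card C"
    unfolding patch_count_def using finC sub by (rule surj_card_le)
  also have "card C = nat (q k) + nat (2 * \<lfloor>T\<rfloor> + 1)"
    unfolding C_def by (simp add: card_Plus)
  finally have "real (patch_count (real_of_int ` toeplitz q) T) \<le> q k + (2 * \<lfloor>T\<rfloor> + 1)"
    using T q_pos[of k] by linarith
  then show "real (patch_count (real_of_int ` toeplitz q) T) \<le> 5 * T"
    using lower T by linarith
qed

text \<open>The patch at \<open>q (k + 1) + 1\<close> violates \<open>q k\<close>-periodicity, so it occurs only close to multiples
  of \<open>q (k + 1)\<close> and misses a large ball centred midway between two of them.\<close>
lemma repetition_radius_toeplitz_gt:
  assumes M: "repetition_radius (real_of_int ` toeplitz q) (q k) M"
  shows "M > q (Suc k) / 2 - q k - 1"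
proof (rule ccontr)
  define Q where "Q = q (Suc k)"
  assume "\<not> M > q (Suc k) / 2 - q k - 1"
  then have small: "M \<le> Q / 2 - q k - 1" unfolding Q_def by simp
  \<comment> \<open>Patches are centred at points of the set. \<open>Q\<close> is one only for odd
    \<open>k\<close>, whereas \<open>Q + 1\<close> has level 0.\<close>
  have "Q + 1 \<in> toeplitz q"
    using toeplitz_add_iff[of "Suc 0" Q 1] one_in_toeplitz q_dvd[of "Suc 0" "Suc k"]
      not_q_Suc_dvd_q[of 0] q_0 unfolding Q_def by simp
  then have "patch (real_of_int ` toeplitz q) (q k) (of_int (Q + 1))
      \<in> atlas_at (real_of_int ` toeplitz q) (q k)" unfolding atlas_at_def by blast
  then have "\<exists>x \<in> real_of_int ` toeplitz q \<inter> cball (Q / 2) M.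
      patch (real_of_int ` toeplitz q) (q k) x =
      patch (real_of_int ` toeplitz q) (q k) (of_int (Q + 1))"
    using M unfolding repetition_radius_def by blast
  then obtain b where b: "\<bar>Q / 2 - real_of_int b\<bar> \<le> M"
    and patch: "patch (real_of_int ` toeplitz q) (q k) (of_int b) =
      patch (real_of_int ` toeplitz q) (q k) (of_int (Q + 1))"
    by (auto simp: dist_real_def)
  have agree: "b + d \<in> toeplitz q \<longleftrightarrow> Q + 1 + d \<in> toeplitz q" if "\<bar>d\<bar> \<le> q k" for d
  proof -
    have "\<bar>real_of_int d\<bar> \<le> q k" using that by linarith
    then show ?thesis using patch unfolding patch_of_int_eq_iff by blast
  qed
  have not_dvd: "\<not> Q dvd b + d" if "\<bar>d\<bar> \<le> q k" for d
  proof
    assume "Q dvd b + d"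
    have "\<bar>real_of_int d\<bar> \<le> q k" using that by linarith
    \<comment> \<open>By \<open>small\<close>, \<open>b + d\<close> stays within
      \<open>Q / 2 - 1\<close> of \<open>Q / 2\<close>, hence strictly between 0 and
      \<open>Q\<close>.\<close>
    then have "real_of_int (b + d) > 0" "real_of_int (b + d) < Q" using b small by (auto simp: abs_le_iff)
    then have "b + d > 0" "b + d < Q" by linarith+
    then show False using \<open>Q dvd b + d\<close> zdvd_not_zless by blast
  qed
  \<comment> \<open>Seen from \<open>Q + 1\<close>, these displacements show \<open>Q\<close>, of
    level \<open>k + 1\<close>, and \<open>Q + q k\<close>, of level \<open>k\<close>, whose
    memberships differ. Seen from \<open>b\<close>, they show two points that differ by
    \<open>q k\<close> and are not multiples of \<open>Q\<close>, so their memberships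
    agree.\<close>
  have k: "\<bar>-1\<bar> \<le> q k" "\<bar>q k - 1\<bar> \<le> q k" using q_pos[of k] by auto
  have "b + -1 \<in> toeplitz q \<longleftrightarrow> b + (q k - 1) \<in> toeplitz q"
    using not_dvd[OF k(1)] not_dvd[OF k(2)] unfolding Q_def by (intro toeplitz_cong[of k]) auto
  then have "Q \<in> toeplitz q \<longleftrightarrow> Q + q k \<in> toeplitz q" using agree[OF k(1)] agree[OF k(2)] by simp
  moreover have "Q + q k \<in> toeplitz q \<longleftrightarrow> even k"
    using toeplitz_add_iff[of "Suc k" Q "q k"] not_q_Suc_dvd_q[of k] q_in_toeplitz_iff[of k]
    unfolding Q_def by simp
  ultimately show False using q_in_toeplitz_iff[of "Suc k"] unfolding Q_def by simp
qed

end

section \<open>Choice of the chain for a given growth function\<close>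

theorem corollary4:
  fixes g :: "real \<Rightarrow> real"
  assumes "growth_function g"
  shows "\<exists>Y :: (real ^ 'n) set.
           translation_minimal Y \<and> aperiodic_set Y \<and> meyer_set Y \<and>
           (\<lambda>T. real (patch_count Y T)) \<in> O[at_top](\<lambda>T. T ^ CARD('n)) \<and>
           (\<exists>S :: nat \<Rightarrow> real.
              filterlim S at_top sequentially \<and>
              (\<forall>i\<ge>1. S i > 0 \<and> repetitivity Y (S i) > g (S i)))"
proof -
  \<comment> \<open>Half of \<open>q (Suc k)\<close> is
    \<open>q k * (2 + \<lceil>\<bar>g (q k)\<bar>\<rceil>)\<close>. Its summand
    \<open>2 * q k\<close> absorbs the losses \<open>q k\<close> and 1 in
    \<open>repetition_radius_toeplitz_gt\<close>, and the rest is at least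
    \<open>g (q k)\<close>.\<close>
  define q where "q = rec_nat (1::int) (\<lambda>_ m. m * (4 + 2 * \<lceil>\<bar>g (of_int m)\<bar>\<rceil>))"
  have q_Suc: "q (Suc k) = q k * (4 + 2 * \<lceil>\<bar>g (q k)\<bar>\<rceil>)" for k unfolding q_def by simp
  have factor: "4 + 2 * \<lceil>\<bar>x\<bar>\<rceil> \<ge> (2::int)" for x :: real by linarith
  have pos: "q k \<ge> 1" for k
  proof (induction k)
    case (Suc k)
    then show ?case using mult_mono[of 1 "q k" 1 "4 + 2 * \<lceil>\<bar>g (q k)\<bar>\<rceil>"] factor[of "g (q k)"]
      unfolding q_Suc by linarith
  qed (simp add: q_def)
  interpret divisor_chain q
  proof
    show "2 * q k \<le> q (Suc k)" for k
      using mult_left_mono[OF factor[of "g (q k)"], of "q k"] pos[of k] unfolding q_Suc by simp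
  qed (simp_all add: q_def)
  define X where "X = real_of_int ` toeplitz q"
  define Y where "Y = (cart_power X :: (real ^ 'n) set)"
  have "Y \<inter> cball c (real CARD('n) * 1) \<noteq> {}" for c
  proof -
    have "\<forall>i. \<exists>x. x \<in> X \<and> \<bar>c $ i - x\<bar> \<le> 1"
      using toeplitz_dense unfolding X_def Bex_def by blast
    then obtain f where f: "\<And>i. f i \<in> X" "\<And>i. \<bar>c $ i - f i\<bar> \<le> 1" by metis
    have "(\<chi> i. f i) \<in> Y \<inter> cball c (real CARD('n) * 1)"
      using f cball_cart_power[of c "\<chi> i. f i" 1] by (simp add: Y_def cart_power_def)
    then show ?thesis by blast
  qed
  moreover have "y $ i \<in> \<int>" if "y \<in> Y" for y i
  proof -
    have "y $ i \<in> X" using that unfolding Y_def cart_power_def by blast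
    then show ?thesis unfolding X_def by auto
  qed
  ultimately have meyer: "meyer_set Y"
    by (intro meyer_setI_integer[of Y "real CARD('n) * 1"]) auto
  then have delone: "delone_set Y" unfolding meyer_set_def by blast
  have rep: "\<exists>M. repetition_radius Y T M" for T
    using repetition_radius_toeplitz repetition_radius_cart_power unfolding Y_def X_def by blast
  have "aperiodic_set Y"
    unfolding Y_def X_def using aperiodic_toeplitz one_in_toeplitz
    by (intro aperiodic_cart_power) auto
  moreover have "(\<lambda>T. real (patch_count Y T)) \<in> O[at_top](\<lambda>T. T ^ CARD('n))"
  proof (rule bigoI)
    show "\<forall>\<^sub>F T in at_top. norm (real (patch_count Y T)) \<le> 5 ^ CARD('n) * norm (T ^ CARD('n))"
      using eventually_ge_at_top[of 1]
    proof eventually_elim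
      case (elim T)
      have "real (patch_count Y T) \<le> real (patch_count X T) ^ CARD('n)"
        unfolding Y_def X_def of_nat_power[symmetric] of_nat_le_iff
        using patch_count_toeplitz_le(1)[OF elim] by (rule patch_count_cart_power_le)
      also have "\<dots> \<le> (5 * T) ^ CARD('n)"
        unfolding X_def using patch_count_toeplitz_le(2)[OF elim] by (intro power_mono) auto
      finally show ?case using elim by (simp add: power_mult_distrib)
    qed
  qed
  moreover have "filterlim (\<lambda>i. real_of_int (q i)) at_top sequentially"
  proof (rule filterlim_at_top_mono[OF filterlim_real_sequentially])
    have "real i \<le> real_of_int (q i)" for i using q_ge_nat[of i] by linarith
    then show "\<forall>\<^sub>F i in sequentially. real i \<le> real_of_int (q i)" by simp
  qed
  moreover have "repetitivity Y (q i) > g (q i)" for i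
  proof -
    have "repetition_radius Y (q i) (repetitivity Y (q i))"
      using rep repetition_radius_repetitivity[OF delone] by blast
    then have "repetitivity Y (q i) > q (Suc i) / 2 - q i - 1"
      unfolding Y_def X_def
      by (intro repetition_radius_toeplitz_gt repetition_radius_cart_powerD)
    moreover have "q (Suc i) / 2 = real_of_int (q i) * (2 + \<lceil>\<bar>g (q i)\<bar>\<rceil>)"
      unfolding q_Suc by (simp add: algebra_simps)
    moreover have "real_of_int (q i) * \<lceil>\<bar>g (q i)\<bar>\<rceil> \<ge> 1 * real_of_int \<lceil>\<bar>g (q i)\<bar>\<rceil>"
      using pos[of i] by (intro mult_right_mono) auto
    moreover have "real_of_int \<lceil>\<bar>g (q i)\<bar>\<rceil> \<ge> g (q i)" "real_of_int (q i) \<ge> 1"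
      using pos[of i] by linarith+
    ultimately show ?thesis by (simp only: distrib_left of_int_add of_int_numeral)
  qed
  ultimately show ?thesis
    using meyer translation_minimal_if_repetitive[OF delone rep] pos
    by (intro exI[of _ Y] conjI exI[of _ "\<lambda>i. real_of_int (q i)"] allI impI)
      (auto simp: int_one_le_iff_zero_less)
qed

end
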